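(* For any two mm-spaces $X$ and $Y$, \[ d_{\mathrm{conc}}(X,Y)=\min_{\pi\in\Pi(m_X,m_Y)} d_{\mathrm{conc}}^{\pi}(X,Y); \] in particular the minimum is attained by some transport plan.
   Context: An mm-space is a complete separable metric space $(X,d_X)$ with a Borel probability measure $m_X$. $\Pi(m_X,m_Y)$: Borel probability measures on $X\times Y$ with marginals $m_X,m_Y$. $\mathcal{L}ip_1(X)$ is the set of 1-Lipschitz functions $X\to\mathbb R$. For a measure space $(Z,\mu)$ and measurable $f,g:Z\to\mathbb R$, the Ky Fan metric is $d_{\mathrm{KF}}^\mu(f,g):=\inf\{\varepsilon\ge0:\mu(\{|f-g|>\varepsilon\})\le\varepsilon\}$; $d_{\mathrm H}^{d_{\mathrm{KF}}^\mu}$ denotes the Hausdorff distance between sets of functions with respect to $d_{\mathrm{KF}}^\mu$. For $F:A\to B$, $G:B\to C$ write $F^*G:=G\circ F$. For $\pi\in\Pi(m_X,m_Y)$, $d_{\mathrm{conc}}^{\pi}(X,Y):=d_{\mathrm H}^{d_{\mathrm{KF}}^\pi}(\mathrm{pr}_1^*\mathcal{L}ip_1(X),\mathrm{pr}_2^*\mathcal{L}ip_1(Y))$. $I=[0,1)$ with Lebesgue measure $\mathcal L^1$; a parameter of $X$ is a Borel $\varphi:I\to X$ with $\varphi_*\mathcal L^1=m_X$. The observable distance is $d_{\mathrm{conc}}(X,Y):=\inf_{\varphi,\psi}d_{\mathrm H}^{d_{\mathrm{KF}}^{\mathcal L^1}}(\varphi^*\mathcal{L}ip_1(X),\psi^*\mathcal{L}ip_1(Y))$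 over parameters $\varphi$ of $X$, $\psi$ of $Y$, where $\varphi^*\mathcal{L}ip_1(X)=\{f\circ\varphi: f\in\mathcal{L}ip_1(X)\}$. *)

theory Defs
  imports "HOL-Probability.Probability"
begin

definition mm_space :: "'a::polish_space measure \<Rightarrow> bool" where
  "mm_space m \<longleftrightarrow> prob_space m \<and> sets m = sets (borel :: 'a measure)"

definition Lip1 :: "('a::metric_space \<Rightarrow> real) set" where
  "Lip1 = {f. \<forall>x y. \<bar>f x - f y\<bar> \<le> dist x y}"

definition dKF :: "'z measure \<Rightarrow> ('z \<Rightarrow> real) \<Rightarrow> ('z \<Rightarrow> real) \<Rightarrow> real" where
  "dKF \<mu> f g = Inf {\<epsilon>. \<epsilon> \<ge> 0 \<and> measure \<mu> {z \<in> space \<mu>. \<bar>f z - g z\<bar> > \<epsilon>} \<le> \<epsilon>}"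

definition hausdorff_dist :: "('b \<Rightarrow> 'b \<Rightarrow> real) \<Rightarrow> 'b set \<Rightarrow> 'b set \<Rightarrow> real" where
  "hausdorff_dist d A B =
     max (SUP a\<in>A. INF b\<in>B. d a b) (SUP b\<in>B. INF a\<in>A. d a b)"

definition transport_plans ::
  "'a::polish_space measure \<Rightarrow> 'b::polish_space measure \<Rightarrow> ('a \<times> 'b) measure set" where
  "transport_plans mX mY = {\<pi>. prob_space \<pi> \<and> sets \<pi> = sets (borel :: ('a \<times> 'b) measure)
       \<and> distr \<pi> borel fst = mX \<and> distr \<pi> borel snd = mY}"

definition dconc_plan :: "('a::polish_space \<times> 'b::polish_space) measure \<Rightarrow> real" where
  "dconc_plan \<pi> = hausdorff_dist (dKF \<pi>)
      ((\<lambda>f. f \<circ> fst) ` (Lip1 :: ('a \<Rightarrow> real) set))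
      ((\<lambda>g. g \<circ> snd) ` (Lip1 :: ('b \<Rightarrow> real) set))"

definition unit_interval_measure :: "real measure" where
  "unit_interval_measure = restrict_space lborel {0..<1}"

definition parameter :: "'a::polish_space measure \<Rightarrow> (real \<Rightarrow> 'a) \<Rightarrow> bool" where
  "parameter m \<phi> \<longleftrightarrow> \<phi> \<in> measurable unit_interval_measure borel
      \<and> distr unit_interval_measure borel \<phi> = m"

definition dconc :: "'a::polish_space measure \<Rightarrow> 'b::polish_space measure \<Rightarrow> real" where
  "dconc mX mY = Inf {hausdorff_dist (dKF unit_interval_measure)
                        ((\<lambda>f. f \<circ> \<phi>) ` (Lip1 :: ('a \<Rightarrow> real) set))
                        ((\<lambda>g. g \<circ> \<psi>) ` (Lip1 :: ('b \<Rightarrow> real) set))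
                      | \<phi> \<psi>. parameter mX \<phi> \<and> parameter mY \<psi>}"

end

theory Submission
  imports Defs "HOL-Complex_Analysis.Great_Picard"
begin

text \<open>
  A Borel coding of a Polish space into the Cantor set by the indicators of a countable base has a
  Borel left inverse, so quantile functions provide parameters for all Borel probability measures.
  Applied to the product of the two spaces, this identifies pairs of parameters with transport plans, and the
  observable distance becomes an infimum over plans.

  Interleaving the codes of the two factors, Helly's selection theorem on the real line yields a
  limit of a minimising sequence of plans. As the marginals are fixed, the limit is again a plan, and its
  value on open sets is at most the limit inferior. Given a 1-Lipschitz function on one side, the
  approximating 1-Lipschitz functions on the other side have a pointwise convergent subsequence;
  it converges in measure uniformly over the plans, because this only involves the fixed marginal.
  Hence the limit plan is a minimiser.
\<close>

section \<open>Coding Polish spaces by ternary expansions\<close>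

text \<open>On 0-1 sequences this is the usual bijection onto the Cantor set, with ternary digits 0
  and 2. The gaps between Cantor pieces are what lets the digits extend to continuous functions of
  the value.\<close>

definition tern :: "(nat \<Rightarrow> real) \<Rightarrow> real" where
  "tern e = (\<Sum>k. 2 * e k / 3 ^ Suc k)"

text \<open>The function is 0 up to 1/3, 1 from 2/3 on, and linear in between. On the Cantor set it
  is half the first digit, so \<open>3 * x - 2 * clamp3 x\<close> is the shift that drops this
  digit.\<close>

definition clamp3 :: "real \<Rightarrow> real" where
  "clamp3 x = max 0 (min 1 (3 * x - 1))"

definition digit :: "nat \<Rightarrow> real \<Rightarrow> real" where
  "digit k x = clamp3 (((\<lambda>x. 3 * x - 2 * clamp3 x) ^^ k) x)"

text \<open>On the Cantor set, \<^const>\<open>digit\<close> \<open>k\<close> reads off the \<open>k\<close>-th ternary digit (halved); unlike the digit itself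
  it is continuous on the whole line.\<close>

lemma digit_bounds: "0 \<le> digit k x" "digit k x \<le> 1"
  by (auto simp: digit_def clamp3_def)

lemma continuous_digit: "continuous_on UNIV (digit k)"
proof -
  have "continuous_on UNIV ((\<lambda>x. 3 * x - 2 * clamp3 x) ^^ k)"
  proof (induction k)
    case (Suc k)
    have "continuous_on UNIV (\<lambda>x. 3 * x - 2 * clamp3 x)"
      unfolding clamp3_def by (intro continuous_intros)
    from continuous_on_compose2[OF this Suc] show ?case by (simp add: o_def)
  qed (simp add: id_def)
  moreover have "continuous_on UNIV clamp3"
    unfolding clamp3_def by (intro continuous_intros)
  ultimately show ?thesis
    unfolding digit_def by (auto intro: continuous_on_compose2)
qed

lemma digit_measurable [measurable]: "digit k \<in> borel_measurable borel"
  by (intro borel_measurable_continuous_onI continuous_digit)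

lemma tern_weights_sums: "(\<lambda>k. 2 / 3 ^ Suc k :: real) sums 1"
  using sums_mult[OF geometric_sums[of "1/3::real"], of "2/3"] by (simp add: power_one_over field_simps)

lemma tern_summable:
  fixes e :: "nat \<Rightarrow> real"
  assumes "\<And>k. 0 \<le> e k" "\<And>k. e k \<le> 1"
  shows "summable (\<lambda>k. 2 * e k / 3 ^ Suc k)"
  by (rule summable_comparison_test'[OF sums_summable[OF tern_weights_sums], of 0])
     (use assms in \<open>auto simp: divide_simps\<close>)

lemma tern_bounds:
  assumes "\<And>k. 0 \<le> e k" "\<And>k. e k \<le> 1"
  shows "0 \<le> tern e" "tern e \<le> 1"
proof -
  show "0 \<le> tern e" unfolding tern_def
    using assms by (intro suminf_nonneg tern_summable) auto
  have "tern e \<le> (\<Sum>k. 2 / 3 ^ Suc k)" unfolding tern_def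
    using assms by (intro suminf_le tern_summable sums_summable[OF tern_weights_sums])
      (auto simp: divide_simps)
  then show "tern e \<le> 1" using sums_unique[OF tern_weights_sums] by simp
qed

lemma tern_Suc:
  assumes "\<And>k. 0 \<le> e k" "\<And>k. e k \<le> 1"
  shows "3 * tern e = 2 * e 0 + tern (\<lambda>k. e (Suc k))"
proof -
  have "tern e = (\<Sum>k. 2 * e (Suc k) / 3 ^ Suc (Suc k)) + 2 * e 0 / 3"
    unfolding tern_def using suminf_split_head[OF tern_summable[of e]] assms by simp
  also have "(\<Sum>k. 2 * e (Suc k) / 3 ^ Suc (Suc k)) = (\<Sum>k. (2 * e (Suc k) / 3 ^ Suc k) / 3)"
    by simp
  also have "\<dots> = tern (\<lambda>k. e (Suc k)) / 3"
    unfolding tern_def using assms by (intro suminf_divide tern_summable) auto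
  finally show ?thesis by simp
qed

text \<open>The tail of the expansion lies in [0, 1], so by \<open>tern_Suc\<close> the value is at
  most 1/3 when \<open>e 0 = 0\<close> and at least 2/3 when \<open>e 0 = 1\<close>. There
  \<open>clamp3\<close> is constant and reads off \<open>e 0\<close>, and the shift reduces the
  later digits to the induction hypothesis.\<close>

lemma digit_tern:
  assumes "\<And>k. e k \<in> {0, 1}"
  shows "digit k (tern e) = e k"
proof -
  have b: "0 \<le> e k" "e k \<le> 1" if "\<And>k. e k \<in> {0, 1}" for e :: "nat \<Rightarrow> real" and k
    using that[of k] by auto
  have c: "clamp3 (tern e) = e 0" if "\<And>k. e k \<in> {0, 1}" for e
    using tern_Suc[of e] tern_bounds[of "\<lambda>k. e (Suc k)"] b[of e, OF that] that[of 0]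
    unfolding clamp3_def by auto
  show ?thesis using assms
  proof (induction k arbitrary: e)
    case 0
    then show ?case by (simp add: digit_def c)
  next
    case (Suc k)
    have "digit (Suc k) (tern e) = digit k (3 * tern e - 2 * clamp3 (tern e))"
      by (simp only: digit_def funpow_Suc_right o_apply)
    also have "\<dots> = digit k (tern (\<lambda>k. e (Suc k)))"
      using tern_Suc[of e] b[of e, OF Suc.prems] c[of e, OF Suc.prems] by simp
    also have "\<dots> = e (Suc k)" using Suc by simp
    finally show ?case .
  qed
qed

text \<open>The entries may take any value in [0, 1], because \<open>digit\<close> does so off the
  Cantor set. This makes rearrangements of digits continuous on the whole line and not only on
  codes.\<close>

lemma continuous_tern:
  assumes "\<And>k. continuous_on UNIV (e k)" "\<And>k x. 0 \<le> e k x" "\<And>k x. e k x \<le> 1"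
  shows "continuous_on UNIV (\<lambda>x. tern (\<lambda>k. e k x))"
proof -
  have "uniform_limit UNIV (\<lambda>n x. \<Sum>k<n. 2 * e k x / 3 ^ Suc k) (\<lambda>x. \<Sum>k. 2 * e k x / 3 ^ Suc k) sequentially"
    by (rule Weierstrass_m_test[OF _ sums_summable[OF tern_weights_sums]])
       (use assms in \<open>auto simp: divide_simps\<close>)
  then show ?thesis unfolding tern_def
    by (rule uniform_limit_theorem[rotated]) (auto intro!: continuous_intros assms always_eventually)
qed

lemma tern_measurable [measurable (raw)]:
  assumes [measurable]: "\<And>k. (\<lambda>x. e x k) \<in> borel_measurable M"
  shows "(\<lambda>x. tern (e x)) \<in> borel_measurable M"
  unfolding tern_def by measurable

text \<open>A point is coded by its membership in the balls of radius 1/(m+1) around a countable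
  dense set. The coding \<open>h\<close> need not be continuous, since indicators of open sets jump.
  Later arguments rely on its Borel left inverse and on the digits recovering membership in the
  basic sets.\<close>

lemma polish_coding:
  obtains h :: "'a::polish_space \<Rightarrow> real" and \<rho> :: "real \<Rightarrow> 'a" and B :: "nat \<Rightarrow> 'a set"
  where "h \<in> borel_measurable borel" "\<rho> \<in> measurable borel borel"
    "\<And>x. \<rho> (h x) = x"
    "\<And>x. tern (\<lambda>k. digit k (h x)) = h x"
    "\<And>k x. digit k (h x) = indicator (B k) x"
    "\<And>k. open (B k)"
    "\<And>U x. open U \<Longrightarrow> x \<in> U \<Longrightarrow> \<exists>k. x \<in> B k \<and> B k \<subseteq> U"
proof -
  obtain D :: "'a set" where D: "countable D" "\<And>X. open X \<Longrightarrow> X \<noteq> {} \<Longrightarrow> \<exists>d\<in>D. d \<in> X"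
    using countable_dense_setE by blast
  define d where "d = from_nat_into D"
  have "D \<noteq> {}" using D(2)[of UNIV] by auto
  then have d: "\<exists>i. dist x (d i) < e" if "e > 0" for x e
    using D(2)[of "ball x e"] that from_nat_into_surj[OF D(1)] unfolding d_def by (metis centre_in_ball empty_iff mem_ball open_ball)
  define B where "B k = ball (d (fst (prod_decode k))) (1 / Suc (snd (prod_decode k)))" for k
  define h where "h x = tern (\<lambda>k. indicator (B k) x)" for x
  have B[measurable]: "B k \<in> sets borel" for k by (simp add: B_def)
  have hm: "h \<in> borel_measurable borel" unfolding h_def by measurable
  have dg: "digit k (h x) = indicator (B k) x" for k x
    unfolding h_def by (intro digit_tern) (auto simp: indicator_def)
  \<comment> \<open>On a code, \<open>K m t\<close> is the first centre whose ball of radius 1/(m+1)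
    contains the coded point, so the centres \<open>a m t\<close> converge to that point.\<close>
  define K where "K m t = (LEAST i. digit (prod_encode (i, m)) t = 1)" for m t
  define a where "a m t = d (K m t)" for m t
  \<comment> \<open>Off the range of \<open>h\<close> the centres may fail to form a Cauchy
    sequence. The set where they do is Borel, so any fixed default value keeps \<open>\<rho>\<close>
    measurable.\<close>
  define \<rho> where "\<rho> t = (if Cauchy (\<lambda>m. a m t) then lim (\<lambda>m. a m t) else d 0)" for t
  have [measurable]: "K m \<in> measurable borel (count_space UNIV)" for m
    unfolding K_def by measurable
  have a[measurable]: "a m \<in> borel_measurable borel" for m
    unfolding a_def by measurable
  have "\<rho> \<in> borel_measurable borel"
  proof (rule borel_measurable_LIMSEQ_metric)
    show "(\<lambda>t. if Cauchy (\<lambda>m. a m t) then a i t else d 0) \<in> borel_measurable borel" for i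
      by measurable
    show "(\<lambda>i. if Cauchy (\<lambda>m. a m t) then a i t else d 0) \<longlonglongrightarrow> \<rho> t" for t
      unfolding \<rho>_def using Cauchy_convergent[of "\<lambda>m. a m t"] by (auto simp: convergent_LIMSEQ_iff)
  qed
  moreover have "\<rho> (h x) = x" for x
  proof -
    have "dist (a m (h x)) x < 1 / Suc m" for m
    proof -
      obtain i where "dist x (d i) < 1 / Suc m" using d[of "1 / Suc m" x] by auto
      then have "digit (prod_encode (i, m)) (h x) = 1" by (simp add: dg B_def dist_commute)
      then have "digit (prod_encode (K m (h x), m)) (h x) = 1" unfolding K_def by (rule LeastI)
      then show ?thesis by (auto simp: dg B_def a_def indicator_def split: if_splits)
    qed
    then have "(\<lambda>m. a m (h x)) \<longlonglongrightarrow> x"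
      by (intro metric_tendsto_imp_tendsto[OF LIMSEQ_inverse_real_of_nat] always_eventually)
         (auto simp: inverse_eq_divide intro: less_imp_le)
    then show ?thesis unfolding \<rho>_def using LIMSEQ_imp_Cauchy limI by auto
  qed
  moreover have "\<exists>k. x \<in> B k \<and> B k \<subseteq> U" if "open U" "x \<in> U" for U x
  proof -
    obtain e where e: "e > 0" "ball x e \<subseteq> U" using \<open>open U\<close> \<open>x \<in> U\<close> by (rule openE)
    obtain m where m: "1 / Suc m < e / 2" using reals_Archimedean[of "e/2"] e(1) by (auto simp: inverse_eq_divide)
    obtain i where i: "dist x (d i) < 1 / Suc m" using d[of "1 / Suc m" x] by auto
    have "B (prod_encode (i, m)) \<subseteq> ball x e"
    proof
      fix y assume "y \<in> B (prod_encode (i, m))"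
      then have "dist (d i) y < 1 / Suc m" by (simp add: B_def)
      then show "y \<in> ball x e" using m i dist_triangle[of x y "d i"] by simp
    qed
    moreover have "x \<in> B (prod_encode (i, m))" using i by (simp add: B_def dist_commute)
    ultimately show ?thesis using e by blast
  qed
  moreover have "tern (\<lambda>k. digit k (h x)) = h x" for x
    by (simp add: dg) (simp add: h_def)
  moreover have "open (B k)" for k by (simp add: B_def)
  ultimately show ?thesis using that[of h \<rho> B] hm dg by simp
qed

section \<open>Parameters and compactness of transport plans\<close>

text \<open>A transport plan is thereby itself a measure on a Polish space and has a
  parameter.\<close>

instance prod :: (polish_space, polish_space) polish_space ..

text \<open>The image of \<open>m\<close> under the coding is a distribution on the line. Its
  quantile function carries Lebesgue measure on the unit interval to this distribution, and the
  decoding map carries it back to \<open>m\<close>.\<close>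

lemma parameter_exists:
  fixes m :: "'a::polish_space measure"
  assumes "mm_space m"
  obtains \<phi> where "parameter m \<phi>"
proof -
  interpret m: prob_space m using assms by (simp add: mm_space_def)
  have [measurable_cong]: "sets m = sets borel" using assms by (simp add: mm_space_def)
  obtain h :: "'a \<Rightarrow> real" and \<rho> where h[measurable]: "h \<in> borel_measurable borel"
    and \<rho>[measurable]: "\<rho> \<in> measurable borel borel" and \<rho>h: "\<And>x. \<rho> (h x) = x"
    by (rule polish_coding) blast
  interpret \<mu>: cdf_distribution "distr m borel h"
    unfolding cdf_distribution_def by (intro m.real_distribution_distr) measurable
  \<comment> \<open>The quantile function is meaningful only on the open interval. The value at 0 is
    arbitrary, since a single point is a null set.\<close>
  define q where "q t = (if t \<in> {0<..<1} then \<mu>.I t else 0)" for t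
  have q[measurable]: "q \<in> borel_measurable borel"
    unfolding q_def using \<mu>.measurable_CI by (subst measurable_restrict_space_iff[symmetric]) auto
  have qu: "q \<in> borel_measurable unit_interval_measure"
    unfolding unit_interval_measure_def by (intro measurable_restrict_space1) measurable
  have "distr unit_interval_measure borel q = distr (restrict_space lborel {0<..<1}) borel \<mu>.I"
  proof (rule measure_eqI)
    fix A assume "A \<in> sets (distr unit_interval_measure borel q)"
    then have [measurable]: "A \<in> sets borel" by simp
    have "emeasure (distr unit_interval_measure borel q) A = emeasure lborel (q -` A \<inter> {0..<1})"
      using qu by (simp add: emeasure_distr)
        (simp add: unit_interval_measure_def space_restrict_space emeasure_restrict_space)
    also have "\<dots> = emeasure lborel (q -` A \<inter> {0<..<1})"
    proof (rule emeasure_eq_AE)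
      show "AE x in lborel. x \<in> q -` A \<inter> {0..<1} \<longleftrightarrow> x \<in> q -` A \<inter> {0<..<1}"
        using AE_lborel_singleton[of 0] by eventually_elim auto
    qed (use measurable_sets[OF q, of A] in auto)
    also have "q -` A \<inter> {0<..<1} = \<mu>.I -` A \<inter> {0<..<1}" by (auto simp: q_def)
    also have "emeasure lborel \<dots> = emeasure (distr (restrict_space lborel {0<..<1}) borel \<mu>.I) A"
      using \<mu>.measurable_CI by (subst emeasure_distr)
        (auto simp: space_restrict_space emeasure_restrict_space intro: measurable_restrict_mono)
    finally show "emeasure (distr unit_interval_measure borel q) A =
      emeasure (distr (restrict_space lborel {0<..<1}) borel \<mu>.I) A" .
  qed simp
  then have "distr unit_interval_measure borel q = distr m borel h"
    using \<mu>.distr_I_eq_M by simp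
  then have "distr unit_interval_measure borel (\<rho> \<circ> q) = distr (distr m borel h) borel \<rho>"
    using distr_distr[OF \<rho> qu] by simp
  also have "\<dots> = m"
    by (simp add: distr_distr o_def \<rho>h distr_id2 \<open>sets m = sets borel\<close>)
  finally have "parameter m (\<rho> \<circ> q)"
    unfolding parameter_def using measurable_comp[OF qu \<rho>] by simp
  then show ?thesis by (rule that)
qed

text \<open>For continuous \<open>P\<close> the functions \<open>iexp (t * P x)\<close> are bounded
  and continuous, so the characteristic functions of the images converge. Along the sequence they
  are constant, and Levy's uniqueness theorem identifies the limit.\<close>

lemma weak_conv_distr_const:
  fixes P :: "real \<Rightarrow> real"
  assumes \<nu>: "\<And>n. real_distribution (\<nu> n)" and N: "real_distribution N" and conv: "weak_conv_m \<nu> N"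
    and P: "continuous_on UNIV P" and eq: "\<And>n. distr (\<nu> n) borel P = \<mu>"
  shows "distr N borel P = \<mu>"
proof -
  interpret N: real_distribution N by fact
  interpret \<nu>: real_distribution "\<nu> n" for n by fact
  have [measurable]: "P \<in> borel_measurable borel" using P by (rule borel_measurable_continuous_onI)
  have "(\<lambda>n. CLINT x|\<nu> n. iexp (t * P x)) \<longlonglongrightarrow> (CLINT x|N. iexp (t * P x))" for t
    by (rule weak_conv_imp_integral_bdd_continuous_conv[OF \<nu> N conv, where B=1])
       (use P in \<open>auto intro!: continuous_intros simp: continuous_on_eq_continuous_at norm_exp_i_times
           simp flip: of_real_mult\<close>)
  moreover have "(CLINT x|\<nu> n. iexp (t * P x)) = char \<mu> t" for n t
    unfolding eq[of n, symmetric] char_def by (subst integral_distr) auto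
  moreover have "(CLINT x|N. iexp (t * P x)) = char (distr N borel P) t" for t
    unfolding char_def by (subst integral_distr) auto
  ultimately have "char (distr N borel P) = char \<mu>"
    by (auto simp: fun_eq_iff LIMSEQ_const_iff)
  then show ?thesis
    using \<nu>.real_distribution_distr[of P 0] by (intro Levy_uniqueness) (auto simp: eq)
qed

text \<open>This writes the indicator of a finite union of rectangles as a polynomial in the digits
  of the two codes, which extends continuously to all real arguments.\<close>

lemma indicator_UN_eq_prod:
  "finite A \<Longrightarrow> indicator (\<Union>i\<in>A. W i) z = (1::real) - (\<Prod>i\<in>A. 1 - indicator (W i) z)"
  by (cases "z \<in> (\<Union>i\<in>A. W i)") (auto simp: indicator_def)

text \<open>Weak compactness is used only for the coded plans on the line. An open set is the
  increasing union of finite unions of basic rectangles; the measures of these finite unions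
  converge, because their indicators are continuous in the code. The bound by \<open>c n\<close>
  along a further subsequence \<open>k\<close> expresses lower semicontinuity in the form needed
  once subsequences of Lipschitz functions have been chosen.\<close>

lemma transport_plans_compact:
  fixes mX :: "'a::polish_space measure" and mY :: "'b::polish_space measure"
  assumes mX: "mm_space mX" and mY: "mm_space mY"
    and \<pi>: "\<And>n::nat. \<pi> n \<in> transport_plans mX mY"
  obtains s \<pi>' where "strict_mono (s :: nat \<Rightarrow> nat)" "\<pi>' \<in> transport_plans mX mY"
    "\<And>U k c c0. \<lbrakk>open U; strict_mono k; \<And>n. measure (\<pi> (s (k n))) U \<le> c n; c \<longlonglongrightarrow> c0\<rbrakk> \<Longrightarrow> measure \<pi>' U \<le> c0"
proof -
  interpret mX: prob_space mX using mX by (simp add: mm_space_def)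
  interpret mY: prob_space mY using mY by (simp add: mm_space_def)
  have sX[measurable_cong]: "sets mX = sets borel" using mX by (simp add: mm_space_def)
  have sY[measurable_cong]: "sets mY = sets borel" using mY by (simp add: mm_space_def)
  interpret \<pi>: prob_space "\<pi> n" for n using \<pi> by (simp add: transport_plans_def)
  have s\<pi>[measurable_cong]: "sets (\<pi> n) = sets borel" for n using \<pi> by (simp add: transport_plans_def)
  have f\<pi>: "distr (\<pi> n) borel fst = mX" "distr (\<pi> n) borel snd = mY" for n
    using \<pi> by (simp_all add: transport_plans_def)
  have fs[measurable]: "fst \<in> borel_measurable (borel :: ('a \<times> 'b) measure)"
    "snd \<in> borel_measurable (borel :: ('a \<times> 'b) measure)"
    by (intro borel_measurable_continuous_onI continuous_intros)+
  obtain hX :: "'a \<Rightarrow> real" and \<rho>X BX where hX[measurable]: "hX \<in> borel_measurable borel"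
    and \<rho>X[measurable]: "\<rho>X \<in> measurable borel borel" and \<rho>hX: "\<And>x. \<rho>X (hX x) = x"
    and tX: "\<And>x. tern (\<lambda>k. digit k (hX x)) = hX x"
    and dX: "\<And>k x. digit k (hX x) = indicator (BX k) x"
    and oX: "\<And>k. open (BX k)" and bX: "\<And>U x. open U \<Longrightarrow> x \<in> U \<Longrightarrow> \<exists>k. x \<in> BX k \<and> BX k \<subseteq> U"
    by (rule polish_coding) blast
  obtain hY :: "'b \<Rightarrow> real" and \<rho>Y BY where hY[measurable]: "hY \<in> borel_measurable borel"
    and \<rho>Y[measurable]: "\<rho>Y \<in> measurable borel borel" and \<rho>hY: "\<And>x. \<rho>Y (hY x) = x"
    and tY: "\<And>x. tern (\<lambda>k. digit k (hY x)) = hY x"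
    and dY: "\<And>k x. digit k (hY x) = indicator (BY k) x"
    and oY: "\<And>k. open (BY k)" and bY: "\<And>U x. open U \<Longrightarrow> x \<in> U \<Longrightarrow> \<exists>k. x \<in> BY k \<and> BY k \<subseteq> U"
    by (rule polish_coding) blast
  \<comment> \<open>The digits of the two codes alternate: even places belong to the first factor,
    odd places to the second.\<close>
  define H where "H z = tern (\<lambda>k. if even k then digit (k div 2) (hX (fst z)) else digit (k div 2) (hY (snd z)))" for z
  define P where "P t = tern (\<lambda>k. digit (2 * k) t)" for t
  define Q where "Q t = tern (\<lambda>k. digit (2 * k + 1) t)" for t
  have cPQ: "continuous_on UNIV P" "continuous_on UNIV Q"
    unfolding P_def Q_def by (intro continuous_tern continuous_digit digit_bounds)+
  then have [measurable]: "P \<in> borel_measurable borel" "Q \<in> borel_measurable borel"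
    by (auto intro: borel_measurable_continuous_onI)
  have H[measurable]: "H \<in> borel_measurable borel" unfolding H_def by measurable
  have dH: "digit k (H z) = (if even k then digit (k div 2) (hX (fst z)) else digit (k div 2) (hY (snd z)))" for k z
    unfolding H_def by (intro digit_tern) (auto simp: dX dY indicator_def)
  have PH: "P (H z) = hX (fst z)" for z unfolding P_def by (simp add: dH tX)
  have QH: "Q (H z) = hY (snd z)" for z unfolding Q_def by (simp add: dH tY)

  \<comment> \<open>The continuous maps \<open>P\<close> and \<open>Q\<close> recover the two codes from the interleaved one, so a weak limit
    of the coded plans keeps the coded marginals and is therefore carried by the range of the coding.\<close>
  define \<nu> where "\<nu> n = distr (\<pi> n) borel H" for n
  have \<nu>: "real_distribution (\<nu> n)" for n unfolding \<nu>_def by (intro \<pi>.real_distribution_distr) measurable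
  have "tight \<nu>" unfolding tight_def
  proof (intro conjI allI impI \<nu>)
    fix \<epsilon> :: real assume "0 < \<epsilon>"
    \<comment> \<open>The codes lie in [0, 1]. The left end is -1 because tightness is tested on
      intervals that exclude their left end, and 0 may be a code.\<close>
    have "-1 < H z \<and> H z \<le> 1" for z
      unfolding H_def by (intro conjI tern_bounds less_le_trans[OF _ tern_bounds(1)]) (auto simp: digit_bounds)
    then have "H -` {-1<..1} = UNIV" by auto
    then have "measure (\<nu> n) {-1<..1} = 1" for n
      unfolding \<nu>_def using \<pi>.prob_space[of n] by (subst measure_distr) auto
    then show "\<exists>a b. a < b \<and> (\<forall>n. 1 - \<epsilon> < measure (\<nu> n) {a<..b})"
      using \<open>0 < \<epsilon>\<close> by (intro exI[of _ "-1"] exI[of _ 1]) auto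
  qed
  from tight_imp_convergent_subsubsequence[OF this strict_mono_id]
  obtain s N where s: "strict_mono s" and N: "real_distribution N" and "weak_conv_m (\<nu> \<circ> id \<circ> s) N" by blast
  then have conv: "weak_conv_m (\<lambda>n. \<nu> (s n)) N" by (simp add: o_def)
  interpret N: real_distribution N by fact
  have NP: "distr N borel P = distr mX borel hX"
  proof (rule weak_conv_distr_const[OF \<nu> N conv cPQ(1)])
    show "distr (\<nu> (s n)) borel P = distr mX borel hX" for n
      unfolding f\<pi>(1)[of "s n", symmetric] by (simp add: \<nu>_def distr_distr o_def PH)
  qed
  have NQ: "distr N borel Q = distr mY borel hY"
  proof (rule weak_conv_distr_const[OF \<nu> N conv cPQ(2)])
    show "distr (\<nu> (s n)) borel Q = distr mY borel hY" for n
      unfolding f\<pi>(2)[of "s n", symmetric] by (simp add: \<nu>_def distr_distr o_def QH)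
  qed
  have "AE x in distr mX borel hX. hX (\<rho>X x) = x"
    by (subst AE_distr_iff) (auto simp: \<rho>hX)
  then have AEX: "AE t in N. hX (\<rho>X (P t)) = P t"
    unfolding NP[symmetric] by (subst (asm) AE_distr_iff) auto
  have "AE x in distr mY borel hY. hY (\<rho>Y x) = x"
    by (subst AE_distr_iff) (auto simp: \<rho>hY)
  then have AEY: "AE t in N. hY (\<rho>Y (Q t)) = Q t"
    unfolding NQ[symmetric] by (subst (asm) AE_distr_iff) auto
  define R where "R t = (\<rho>X (P t), \<rho>Y (Q t))" for t
  have R[measurable]: "R \<in> measurable borel borel"
    unfolding R_def borel_prod[symmetric] by measurable
  define \<pi>' where "\<pi>' = distr N borel R"
  interpret \<pi>': prob_space \<pi>' unfolding \<pi>'_def by (rule N.prob_space_distr) measurable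
  have "distr \<pi>' borel fst = distr (distr N borel P) borel \<rho>X"
    by (simp add: \<pi>'_def distr_distr o_def R_def)
  also have "\<dots> = mX"
    unfolding NP by (simp add: distr_distr o_def \<rho>hX distr_id2 sX)
  finally have 1: "distr \<pi>' borel fst = mX" .
  have "distr \<pi>' borel snd = distr (distr N borel Q) borel \<rho>Y"
    by (simp add: \<pi>'_def distr_distr o_def R_def)
  also have "\<dots> = mY"
    unfolding NQ by (simp add: distr_distr o_def \<rho>hY distr_id2 sY)
  finally have 2: "distr \<pi>' borel snd = mY" .
  have "\<pi>' \<in> transport_plans mX mY"
    unfolding transport_plans_def using 1 2 \<pi>'.prob_space_axioms by (simp add: \<pi>'_def)
  moreover have "measure \<pi>' U \<le> c0"
    if U: "open U" and r: "strict_mono r" and le: "\<And>n. measure (\<pi> (s (r n))) U \<le> c n"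
      and c: "c \<longlonglongrightarrow> c0" for U r c c0
  proof -
    have [measurable]: "U \<in> sets borel" using U by simp
    define W where "W i = BX (fst (prod_decode i)) \<times> BY (snd (prod_decode i))" for i
    \<comment> \<open>Cutting off at index \<open>k\<close> keeps the union finite; as
      \<open>k\<close> grows the unions increase to \<open>U\<close>.\<close>
    define A where "A k = {i. i < k \<and> W i \<subseteq> U}" for k
    define V where "V k = (\<Union>i\<in>A k. W i)" for k
    have [simp]: "finite (A k)" for k by (simp add: A_def)
    have [measurable]: "W i \<in> sets borel" for i
      unfolding W_def by (intro borel_open open_Times oX oY)
    have V[measurable]: "V k \<in> sets borel" for k
      unfolding V_def by (intro sets.finite_UN) auto
    have "(\<Union>k. V k) = U"
    proof
      show "(\<Union>k. V k) \<subseteq> U" by (auto simp: V_def A_def)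
      show "U \<subseteq> (\<Union>k. V k)"
      proof
        fix z assume "z \<in> U"
        then obtain S T where ST: "open S" "open T" "z \<in> S \<times> T" "S \<times> T \<subseteq> U" using open_prod_elim[OF U] by blast
        obtain i where i: "fst z \<in> BX i" "BX i \<subseteq> S" using bX[OF ST(1), of "fst z"] ST(3) by auto
        obtain j where j: "snd z \<in> BY j" "BY j \<subseteq> T" using bY[OF ST(2), of "snd z"] ST(3) by auto
        have "z \<in> W (prod_encode (i, j))" "W (prod_encode (i, j)) \<subseteq> U"
          using i j ST by (auto simp: W_def mem_Times_iff)
        then have "z \<in> V (Suc (prod_encode (i, j)))" by (auto simp: V_def A_def)
        then show "z \<in> (\<Union>k. V k)" by blast
      qed
    qed
    moreover have "incseq V" unfolding incseq_def V_def A_def by (intro allI impI UN_mono) auto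
    ultimately have limV: "(\<lambda>k. measure \<pi>' (V k)) \<longlonglongrightarrow> measure \<pi>' U"
      using \<pi>'.finite_Lim_measure_incseq[of V] V by (auto simp: \<pi>'_def image_subset_iff)
    have "measure \<pi>' (V k) \<le> c0" for k
    proof -
      \<comment> \<open>In the product formula for the indicator of \<open>V k\<close>, membership
        in a rectangle is replaced by a product of two digits. The result is continuous on the line
        and agrees with the indicator wherever \<open>P t\<close> and \<open>Q t\<close> are genuine
        codes, which by \<open>AEX\<close> and \<open>AEY\<close> holds almost everywhere for the
        limit too.\<close>
      define F where "F t = 1 - (\<Prod>i\<in>A k. 1 - digit (fst (prod_decode i)) (P t) * digit (snd (prod_decode i)) (Q t))" for t
      have cd: "continuous_on UNIV (\<lambda>t. digit i (P t))" "continuous_on UNIV (\<lambda>t. digit i (Q t))" for i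
        by (rule continuous_on_compose2[OF continuous_digit]; use cPQ in auto)+
      have cF: "continuous_on UNIV F"
        unfolding F_def by (intro continuous_intros cd)
      then have [measurable]: "F \<in> borel_measurable borel" by (rule borel_measurable_continuous_onI)
      have FV: "F t = indicator (V k) (x, y)" if "P t = hX x" "Q t = hY y" for t x y
        unfolding F_def V_def by (simp add: indicator_UN_eq_prod that dX dY W_def indicator_times)
      have F1: "norm (F t) \<le> 1" for t
      proof -
        have "0 \<le> digit i (P t) * digit j (Q t)" "digit i (P t) * digit j (Q t) \<le> 1" for i j
          using digit_bounds by (auto intro: mult_le_one)
        then have "0 \<le> (\<Prod>i\<in>A k. 1 - digit (fst (prod_decode i)) (P t) * digit (snd (prod_decode i)) (Q t))"
          "(\<Prod>i\<in>A k. 1 - digit (fst (prod_decode i)) (P t) * digit (snd (prod_decode i)) (Q t)) \<le> 1"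
          by (auto intro!: prod_nonneg prod_le_1)
        then show ?thesis by (simp add: F_def)
      qed
      have "(\<lambda>n. integral\<^sup>L (\<nu> (s n)) F) \<longlonglongrightarrow> integral\<^sup>L N F"
        by (rule weak_conv_imp_integral_bdd_continuous_conv[OF \<nu> N conv _ F1])
           (use cF in \<open>auto simp: continuous_on_eq_continuous_at\<close>)
      then have "(\<lambda>n. integral\<^sup>L (\<nu> (s (r n))) F) \<longlonglongrightarrow> integral\<^sup>L N F"
        using LIMSEQ_subseq_LIMSEQ[OF _ r] by (auto simp: o_def)
      moreover have "integral\<^sup>L (\<nu> n) F = measure (\<pi> n) (V k)" for n
      proof -
        have "F (H z) = indicator (V k) z" for z
          using FV[of "H z" "fst z" "snd z"] PH QH by simp
        then show ?thesis
          unfolding \<nu>_def by (subst integral_distr) auto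
      qed
      moreover have "measure (\<pi> (s (r n))) (V k) \<le> c n" for n
        by (rule order_trans[OF \<pi>.finite_measure_mono le]) (auto simp: V_def A_def s\<pi>)
      ultimately have "integral\<^sup>L N F \<le> c0"
        using c by (auto intro: LIMSEQ_le)
      moreover have "integral\<^sup>L N F = (\<integral>t. indicator (V k) (R t) \<partial>N)"
      proof (rule integral_cong_AE)
        show "AE t in N. F t = indicator (V k) (R t)"
          using AEX AEY by eventually_elim (auto simp: R_def intro!: FV)
      qed auto
      moreover have "(\<integral>t. indicator (V k) (R t) \<partial>N) = measure \<pi>' (V k)"
        unfolding \<pi>'_def by (subst integral_distr[symmetric, where f="indicator (V k)" and N=borel]) auto
      ultimately show ?thesis by simp
    qed
    then show ?thesis using limV by (auto intro: LIMSEQ_le_const2)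
  qed
  ultimately show ?thesis using that s by blast
qed

section \<open>Lipschitz functions, Ky Fan metric and Hausdorff distance\<close>

lemma Lip1_D: "f \<in> Lip1 \<Longrightarrow> \<bar>f x - f y\<bar> \<le> dist x y"
  by (simp add: Lip1_def)

lemma Lip1_nonempty: "Lip1 \<noteq> {}"
proof -
  have "(\<lambda>_. 0) \<in> Lip1" by (simp add: Lip1_def)
  then show ?thesis by blast
qed

lemma Lip1_continuous:
  assumes "f \<in> Lip1" shows "continuous_on A f"
  unfolding continuous_on_iff using Lip1_D[OF assms] by (metis dist_real_def le_less_trans)

lemma Lip1_measurable: "f \<in> Lip1 \<Longrightarrow> f \<in> borel_measurable borel"
  by (intro borel_measurable_continuous_onI Lip1_continuous)

lemma Lip1_lim:
  assumes "\<And>n. g n \<in> Lip1" "\<And>y. (\<lambda>n. g n y) \<longlonglongrightarrow> G y"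
  shows "G \<in> Lip1"
  unfolding Lip1_def
proof (intro CollectI allI)
  fix x y
  have "(\<lambda>n. \<bar>g n x - g n y\<bar>) \<longlonglongrightarrow> \<bar>G x - G y\<bar>" by (intro tendsto_intros assms)
  then show "\<bar>G x - G y\<bar> \<le> dist x y"
    by (rule LIMSEQ_le_const2) (use Lip1_D[OF assms(1)] in blast)
qed

text \<open>A diagonal argument gives convergence on a countable dense set, and the common Lipschitz
  constant spreads the Cauchy property to every point. Convergence is only pointwise, as the space
  need not be locally compact.\<close>

lemma Lip1_convergent_subsequence:
  fixes g :: "nat \<Rightarrow> 'a::{metric_space, second_countable_topology} \<Rightarrow> real"
  assumes g: "\<And>n. g n \<in> Lip1" and C: "\<And>n. \<bar>g n y0\<bar> \<le> C"
  obtains k G where "strict_mono (k :: nat \<Rightarrow> nat)" "G \<in> Lip1" "\<And>y. (\<lambda>n. g (k n) y) \<longlonglongrightarrow> G y"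
proof -
  obtain D :: "'a set" where D: "countable D" "\<And>X. open X \<Longrightarrow> X \<noteq> {} \<Longrightarrow> \<exists>d\<in>D. d \<in> X"
    using countable_dense_setE by blast
  \<comment> \<open>The Lipschitz condition bounds \<open>g n y\<close> by
    \<open>C + dist y y0\<close>. Dividing by \<open>w y\<close> gives the uniform bound 1 required
    by the diagonal argument; the summand 1 keeps the divisor positive.\<close>
  define w where "w y = C + 1 + dist y y0" for y
  have "C \<ge> 0" using C[of 0] by linarith
  then have w: "w y > 0" for y by (simp add: w_def add_pos_nonneg)
  have "norm (g n y / w y) \<le> 1" for n y
    using Lip1_D[OF g, of n y y0] C[of n] w[of y] by (simp add: w_def)
  then obtain k where k: "strict_mono k" and kl: "\<And>y. y \<in> D \<Longrightarrow> \<exists>l. (\<lambda>n. g (k n) y / w y) \<longlonglongrightarrow> l"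
    by (rule function_convergent_subsequence[of D "\<lambda>n y. g n y / w y" 1, OF D(1)]) (rule that)
  have "\<exists>l. (\<lambda>n. g (k n) y) \<longlonglongrightarrow> l" if y: "y \<in> D" for y
  proof -
    from kl[OF y] obtain l where "(\<lambda>n. g (k n) y / w y) \<longlonglongrightarrow> l" by blast
    from tendsto_mult_right[OF this, of "w y"] show ?thesis using w[of y] by auto
  qed
  then have CD: "Cauchy (\<lambda>n. g (k n) y)" if "y \<in> D" for y
    using that LIMSEQ_imp_Cauchy by blast
  have "Cauchy (\<lambda>n. g (k n) y)" for y
  proof (rule metric_CauchyI)
    fix e :: real assume "0 < e"
    then obtain d where d: "d \<in> D" "dist y d < e / 3" using D(2)[of "ball y (e/3)"] by auto
    obtain M where M: "\<And>m n. m \<ge> M \<Longrightarrow> n \<ge> M \<Longrightarrow> dist (g (k m) d) (g (k n) d) < e / 3"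
      using metric_CauchyD[OF CD[OF d(1)], of "e/3"] \<open>0 < e\<close> by auto
    have "dist (g (k m) y) (g (k n) y) < e" if "m \<ge> M" "n \<ge> M" for m n
      using M[OF that] d(2) Lip1_D[OF g, of "k m" y d] Lip1_D[OF g, of "k n" y d]
      unfolding dist_real_def by linarith
    then show "\<exists>M. \<forall>m\<ge>M. \<forall>n\<ge>M. dist (g (k m) y) (g (k n) y) < e" by blast
  qed
  then have "\<exists>G. \<forall>y. (\<lambda>n. g (k n) y) \<longlonglongrightarrow> G y"
    by (intro choice allI) (meson Cauchy_convergent convergent_def)
  then obtain G where G: "\<And>y. (\<lambda>n. g (k n) y) \<longlonglongrightarrow> G y" by blast
  show ?thesis by (rule that[OF k Lip1_lim[of "\<lambda>n. g (k n)", OF g G] G])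
qed

section \<open>Elementary estimates for the Ky Fan metric and the Hausdorff distance\<close>

lemma dKF_le:
  assumes "0 \<le> \<epsilon>" "measure \<mu> {z \<in> space \<mu>. \<bar>f z - g z\<bar> > \<epsilon>} \<le> \<epsilon>"
  shows "dKF \<mu> f g \<le> \<epsilon>"
  unfolding dKF_def using assms by (intro cInf_lower bdd_belowI[of _ 0]) auto

lemma (in prob_space) dKF_le_1: "dKF M f g \<le> 1"
  by (rule dKF_le) auto

lemma (in prob_space) dKF_nonneg: "0 \<le> dKF M f g"
  unfolding dKF_def by (intro cInf_greatest) (auto intro!: exI[of _ 1])

lemma dKF_commute: "dKF \<mu> f g = dKF \<mu> g f"
  unfolding dKF_def by (simp add: abs_minus_commute)

text \<open>Strictness yields an admissible level below \<open>c\<close>, and the exceedance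
  probability decreases with the level; attainment of the infimum need not be discussed.\<close>

lemma (in prob_space) dKF_lessD:
  assumes [measurable]: "f \<in> borel_measurable M" "g \<in> borel_measurable M" and less: "dKF M f g < c"
  shows "prob {z \<in> space M. \<bar>f z - g z\<bar> > c} \<le> c"
proof -
  have "{\<epsilon>. \<epsilon> \<ge> 0 \<and> prob {z \<in> space M. \<bar>f z - g z\<bar> > \<epsilon>} \<le> \<epsilon>} \<noteq> {}"
    by (auto intro!: exI[of _ 1])
  from cInf_lessD[OF this less[unfolded dKF_def]]
  obtain \<epsilon> where \<epsilon>: "prob {z \<in> space M. \<bar>f z - g z\<bar> > \<epsilon>} \<le> \<epsilon>" "\<epsilon> < c" by auto
  have "prob {z \<in> space M. \<bar>f z - g z\<bar> > c} \<le> prob {z \<in> space M. \<bar>f z - g z\<bar> > \<epsilon>}"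
    using \<epsilon>(2) by (intro finite_measure_mono) auto
  then show ?thesis using \<epsilon> by simp
qed

lemma dKF_distr:
  assumes [measurable]: "\<Phi> \<in> measurable M N" "f \<in> borel_measurable N" "g \<in> borel_measurable N"
  shows "dKF (distr M N \<Phi>) f g = dKF M (f \<circ> \<Phi>) (g \<circ> \<Phi>)"
proof -
  have "measure (distr M N \<Phi>) {z \<in> space (distr M N \<Phi>). \<bar>f z - g z\<bar> > \<epsilon>} =
      measure M {z \<in> space M. \<bar>(f \<circ> \<Phi>) z - (g \<circ> \<Phi>) z\<bar> > \<epsilon>}" for \<epsilon>
    by (subst measure_distr) (auto intro!: arg_cong[where f="measure M"] dest: measurable_space[OF assms(1)])
  then show ?thesis unfolding dKF_def by simp
qed

lemma hausdorff_dist_le: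
  assumes "A \<noteq> {}" "B \<noteq> {}" "\<And>a b. 0 \<le> d a b"
    and "\<And>a. a \<in> A \<Longrightarrow> \<exists>b\<in>B. d a b \<le> \<delta>" "\<And>b. b \<in> B \<Longrightarrow> \<exists>a\<in>A. d a b \<le> (\<delta>::real)"
  shows "hausdorff_dist d A B \<le> \<delta>"
  unfolding hausdorff_dist_def
proof (intro max.boundedI cSUP_least assms(1,2))
  have bdd: "bdd_below ((\<lambda>b. d a b) ` B)" "bdd_below ((\<lambda>a. d a b) ` A)" for a b
    using assms(3) by (auto intro!: bdd_belowI[of _ 0])
  show "(INF b\<in>B. d a b) \<le> \<delta>" if "a \<in> A" for a
    using assms(4)[OF that] cINF_lower[OF bdd(1)] order_trans by blast
  show "(INF a\<in>A. d a b) \<le> \<delta>" if "b \<in> B" for b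
    using assms(5)[OF that] cINF_lower[OF bdd(2)] order_trans by blast
qed

text \<open>Real infima and suprema are meaningful only for bounded families: the bound 0 serves the
  infima and the bound 1 the suprema. A strict inequality then turns an infimum into a
  witness.\<close>

lemma
  assumes "A \<noteq> {}" "B \<noteq> {}" "\<And>a b. 0 \<le> d a b" "\<And>a b. d a b \<le> (1::real)"
  shows hausdorff_dist_nonneg: "0 \<le> hausdorff_dist d A B"
    and hausdorff_dist_lessD1: "\<And>a c. hausdorff_dist d A B < c \<Longrightarrow> a \<in> A \<Longrightarrow> \<exists>b\<in>B. d a b < c"
    and hausdorff_dist_lessD2: "\<And>b c. hausdorff_dist d A B < c \<Longrightarrow> b \<in> B \<Longrightarrow> \<exists>a\<in>A. d a b < c"
proof -
  have bdd: "bdd_below ((\<lambda>b. d a b) ` B)" "bdd_below ((\<lambda>a. d a b) ` A)" for a b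
    using assms(3) by (auto intro!: bdd_belowI[of _ 0])
  obtain a0 b0 where ab: "a0 \<in> A" "b0 \<in> B" using assms(1,2) by blast
  have "(INF b\<in>B. d a b) \<le> 1" "(INF a\<in>A. d a b) \<le> 1" for a b
    using cINF_lower[OF bdd(1) ab(2), of a] cINF_lower[OF bdd(2) ab(1), of b] assms(4) order_trans by blast+
  then have bdd': "bdd_above ((\<lambda>a. INF b\<in>B. d a b) ` A)" "bdd_above ((\<lambda>b. INF a\<in>A. d a b) ` B)"
    by (auto intro!: bdd_aboveI[of _ 1])
  have 1: "(INF b\<in>B. d a b) \<le> hausdorff_dist d A B" if "a \<in> A" for a
    unfolding hausdorff_dist_def using cSUP_upper[OF that bdd'(1)] by simp
  have 2: "(INF a\<in>A. d a b) \<le> hausdorff_dist d A B" if "b \<in> B" for b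
    unfolding hausdorff_dist_def using cSUP_upper[OF that bdd'(2)] by simp
  show "0 \<le> hausdorff_dist d A B"
    by (rule order_trans[OF _ 1[OF ab(1)]]) (use assms in \<open>auto intro!: cINF_greatest\<close>)
  show "\<exists>b\<in>B. d a b < c" if "hausdorff_dist d A B < c" "a \<in> A" for a c
    using 1[OF that(2)] that(1) cINF_less_iff[OF assms(2) bdd(1)] by (meson le_less_trans)
  show "\<exists>a\<in>A. d a b < c" if "hausdorff_dist d A B < c" "b \<in> B" for b c
    using 2[OF that(2)] that(1) cINF_less_iff[OF assms(1) bdd(2)] by (meson le_less_trans)
qed

section \<open>Tails, convergence in measure, and limits of approximating Lipschitz
  functions\<close>

lemma (in prob_space) exists_small_tail:
  fixes X :: "'a \<Rightarrow> real"
  assumes [measurable]: "X \<in> borel_measurable M" and "0 < \<epsilon>"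
  obtains K where "0 \<le> K" "prob {x \<in> space M. \<bar>X x\<bar> > K} < \<epsilon>"
proof -
  define T where "T n = {x \<in> space M. \<bar>X x\<bar> > real n}" for n
  have T: "T n \<in> events" for n unfolding T_def by measurable
  have "(\<Inter>n. T n) = {}"
  proof -
    have "\<exists>n. x \<notin> T n" for x
      using reals_Archimedean2[of "\<bar>X x\<bar>"] by (auto simp: T_def not_less intro: less_imp_le)
    then show ?thesis by auto
  qed
  moreover have "decseq T" by (auto simp: decseq_def T_def)
  ultimately have "(\<lambda>n. prob (T n)) \<longlonglongrightarrow> 0"
    using finite_Lim_measure_decseq[of T] by (simp add: image_subset_iff T)
  then have "\<exists>n. prob (T n) < \<epsilon>"
    using \<open>0 < \<epsilon>\<close> order_tendstoD(2) eventually_happens trivial_limit_sequentially by blast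
  then show ?thesis using that unfolding T_def by (metis of_nat_0_le_iff)
qed

lemma (in prob_space) pointwise_tendsto_imp_in_measure:
  fixes g :: "nat \<Rightarrow> 'a \<Rightarrow> real"
  assumes [measurable]: "\<And>n. g n \<in> borel_measurable M" "G \<in> borel_measurable M"
    and lim: "\<And>x. x \<in> space M \<Longrightarrow> (\<lambda>n. g n x) \<longlonglongrightarrow> G x" and "0 < \<eta>"
  shows "(\<lambda>n. prob {x \<in> space M. \<bar>g n x - G x\<bar> > \<eta>}) \<longlonglongrightarrow> 0"
proof -
  define S where "S n = {x \<in> space M. \<bar>g n x - G x\<bar> > \<eta>}" for n
  have [measurable]: "S n \<in> sets M" for n unfolding S_def by measurable
  have "(\<lambda>n. \<integral>x. indicator (S n) x \<partial>M) \<longlonglongrightarrow> (\<integral>x. (0::real) \<partial>M)"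
  proof (rule integral_dominated_convergence[where w="\<lambda>_. 1"])
    show "AE x in M. (\<lambda>n. indicator (S n) x :: real) \<longlonglongrightarrow> 0"
    proof (rule AE_I2)
      fix x assume "x \<in> space M"
      from tendstoD[OF lim[OF this] \<open>0 < \<eta>\<close>]
      have "eventually (\<lambda>n. indicator (S n) x = (0::real)) sequentially"
        by eventually_elim (auto simp: S_def dist_real_def indicator_def)
      then show "(\<lambda>n. indicator (S n) x :: real) \<longlonglongrightarrow> 0" by (rule tendsto_eventually)
    qed
  qed (auto simp: indicator_def)
  then show ?thesis by (simp add: S_def[symmetric])
qed

text \<open>With \<open>F\<close> and \<open>q\<close> kept general, one argument serves both halves
  of the Hausdorff distance. The laws of \<open>F\<close> and \<open>q\<close> do not depend on
  \<open>n\<close>, so tail bounds and convergence in measure are uniform in \<open>n\<close>; only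
  the joint law changes, and it is controlled through open sets.\<close>

lemma Lip1_approximation_limit:
  fixes F :: "'z::topological_space \<Rightarrow> real" and q :: "'z \<Rightarrow> 'b::polish_space"
  assumes M: "\<And>n::nat. prob_space (M n)" "\<And>n. sets (M n) = sets borel"
    and N: "prob_space N" "sets N = sets borel"
    and F: "continuous_on UNIV F" and q: "continuous_on UNIV q"
    and MF: "\<And>n. distr (M n) borel F = \<mu>" and Mq: "\<And>n. distr (M n) borel q = m"
    and lsc: "\<And>U k c c0. \<lbrakk>open U; strict_mono k; \<And>n. measure (M (k n)) U \<le> c n; c \<longlonglongrightarrow> c0\<rbrakk>
      \<Longrightarrow> measure N U \<le> c0"
    and g: "\<And>n. g n \<in> Lip1" and gc: "\<And>n. dKF (M n) F (g n \<circ> q) < c n"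
    and c: "c \<longlonglongrightarrow> \<delta>" and "\<delta> < 1"
  obtains G where "G \<in> Lip1" "dKF N F (G \<circ> q) \<le> \<delta>"
proof -
  interpret M: prob_space "M n" for n by fact
  interpret N: prob_space N by fact
  have [measurable_cong]: "sets (M n) = sets borel" for n by fact
  have [measurable_cong]: "sets N = sets borel" by fact
  have [simp]: "space (M n) = UNIV" for n using sets_eq_imp_space_eq[OF M(2)] by simp
  have [simp]: "space N = UNIV" using sets_eq_imp_space_eq[OF N(2)] by simp
  have [measurable]: "F \<in> borel_measurable borel" "q \<in> borel_measurable borel" "\<And>n. g n \<in> borel_measurable borel"
    using F q g by (auto intro: borel_measurable_continuous_onI Lip1_measurable)
  interpret \<mu>: prob_space \<mu> unfolding MF[of 0, symmetric] by (rule M.prob_space_distr) measurable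
  interpret m: prob_space m unfolding Mq[of 0, symmetric] by (rule M.prob_space_distr) measurable
  have s\<mu>[measurable_cong]: "sets \<mu> = sets borel" unfolding MF[of 0, symmetric] by simp
  have sm[measurable_cong]: "sets m = sets borel" unfolding Mq[of 0, symmetric] by simp
  have [simp]: "space m = UNIV" "space \<mu> = UNIV"
    using sets_eq_imp_space_eq[OF sm] sets_eq_imp_space_eq[OF s\<mu>] by auto
  have pull: "measure m {y. R y} = measure (M n) {z. R (q z)}" if [measurable]: "{y. R y} \<in> sets borel" for R n
    unfolding Mq[of n, symmetric] by (subst measure_distr) (auto simp: vimage_def)
  have dM: "measure (M n) {z. \<bar>F z - g n (q z)\<bar> > c n} \<le> c n" for n
    using M.dKF_lessD[OF _ _ gc[of n]] by simp
  have "0 \<le> c n" for n using gc[of n] M.dKF_nonneg[of n F "g n \<circ> q"] by simp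
  then have "0 \<le> \<delta>" using c by (auto intro: LIMSEQ_le_const)
  \<comment> \<open>The midpoint of \<delta> and 1: eventually \<open>c n < c'\<close>, and the
    remaining mass \<open>1 - c'\<close> is divided between the tails of \<open>F\<close> and of
    \<open>q\<close>.\<close>
  define c' where "c' = (1 + \<delta>) / 2"
  have c': "c' < 1" "\<delta> < c'" using \<open>\<delta> < 1\<close> by (auto simp: c'_def)
  obtain n0 where n0: "\<And>n. n \<ge> n0 \<Longrightarrow> c n < c'"
    using order_tendstoD(2)[OF c c'(2)] by (auto simp: eventually_sequentially)
  define y0 :: 'b where "y0 = undefined"
  obtain K1 where K1: "0 \<le> K1" "measure \<mu> {x. \<bar>x\<bar> > K1} < (1 - c') / 2"
    using \<mu>.exists_small_tail[of "\<lambda>x. x" "(1 - c') / 2"] c' by auto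
  obtain K2 where K2: "0 \<le> K2" "measure m {y. dist y y0 > K2} < (1 - c') / 2"
    using m.exists_small_tail[of "\<lambda>y. dist y y0" "(1 - c') / 2"] c' by auto
  \<comment> \<open>If \<open>g n y0\<close> were large, then \<open>F\<close> and \<open>g n \<circ> q\<close> would differ on a set of measure close to 1.\<close>
  have bound: "\<bar>g n y0\<bar> \<le> K1 + K2 + 1" if "n \<ge> n0" for n
  proof -
    define E1 E2 E3 where "E1 = {z. \<bar>F z\<bar> > K1}" and "E2 = {z. dist (q z) y0 > K2}"
      and "E3 = {z. \<bar>F z - g n (q z)\<bar> > c n}"
    have E[measurable]: "E1 \<in> sets (M n)" "E2 \<in> sets (M n)" "E3 \<in> sets (M n)"
      unfolding E1_def E2_def E3_def by measurable
    have "measure (M n) E1 = measure \<mu> {x. \<bar>x\<bar> > K1}"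
      unfolding MF[of n, symmetric] E1_def by (subst measure_distr) (auto simp: vimage_def)
    moreover have "measure (M n) E2 = measure m {y. dist y y0 > K2}"
      unfolding E2_def by (subst pull[of _ n]) auto
    moreover have "measure (M n) E3 \<le> c'" using dM[of n] n0[OF that] by (simp add: E3_def)
    ultimately have "measure (M n) E1 + measure (M n) E2 + measure (M n) E3 < 1"
      using K1 K2 by (simp add: field_simps)
    moreover have "measure (M n) (E1 \<union> E2 \<union> E3) \<le> measure (M n) E1 + measure (M n) E2 + measure (M n) E3"
      using measure_Un_le[of "E1 \<union> E2" "M n" E3] measure_Un_le[of E1 "M n" E2] E by auto
    ultimately have "E1 \<union> E2 \<union> E3 \<noteq> UNIV" using M.prob_space[of n] by auto
    then obtain z where "z \<notin> E1 \<union> E2 \<union> E3" by blast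
    then have "\<bar>F z\<bar> \<le> K1" "dist (q z) y0 \<le> K2" "\<bar>F z - g n (q z)\<bar> \<le> c n"
      by (auto simp: E1_def E2_def E3_def)
    then show ?thesis using Lip1_D[OF g, of n "q z" y0] n0[OF that] c' by linarith
  qed
  obtain k G where k: "strict_mono k" and G: "G \<in> Lip1" and lim: "\<And>y. (\<lambda>n. g (k n + n0) y) \<longlonglongrightarrow> G y"
    by (rule Lip1_convergent_subsequence[of "\<lambda>n. g (n + n0)" y0 "K1 + K2 + 1"]) (use g bound in auto)
  have [measurable]: "G \<in> borel_measurable borel" using G by (rule Lip1_measurable)
  define r where "r n = k n + n0" for n
  have r: "strict_mono r" using k by (simp add: r_def strict_mono_def)
  have cr: "(\<lambda>n. c (r n)) \<longlonglongrightarrow> \<delta>" using LIMSEQ_subseq_LIMSEQ[OF c r] by (simp add: o_def)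
  have "dKF N F (G \<circ> q) \<le> \<delta> + \<epsilon>" if "0 < \<epsilon>" for \<epsilon>
  proof -
    \<comment> \<open>Half of the excess absorbs \<open>c (r n) - \<delta>\<close>, the other half
      the difference between \<open>g (r n)\<close> and \<open>G\<close>.\<close>
    define \<eta> where "\<eta> = \<epsilon> / 2"
    have \<eta>: "0 < \<eta>" using that by (simp add: \<eta>_def)
    define a where "a n = measure m {y. \<bar>g (r n) y - G y\<bar> > \<eta>}" for n
    have a: "a \<longlonglongrightarrow> 0"
      using m.pointwise_tendsto_imp_in_measure[of "\<lambda>n. g (r n)" G \<eta>] lim \<eta> by (simp add: r_def a_def[abs_def])
    \<comment> \<open>The strict inequality between continuous functions makes \<open>U\<close>
      open, so bounds on its measure pass to \<open>N\<close>.\<close>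
    define U where "U = {z. \<bar>F z - G (q z)\<bar> > \<delta> + \<epsilon>}"
    have "open U" unfolding U_def
      by (intro open_Collect_less continuous_intros F continuous_on_compose2[OF Lip1_continuous[OF G, of UNIV] q]) auto
    obtain n1 where n1: "\<And>n. n \<ge> n1 \<Longrightarrow> c (r n) < \<delta> + \<eta>"
      using order_tendstoD(2)[OF cr, of "\<delta> + \<eta>"] \<eta> by (auto simp: eventually_sequentially)
    have "measure N U \<le> \<delta> + 0"
    proof (rule lsc[of U "\<lambda>n. r (n + n1)" "\<lambda>n. c (r (n + n1)) + a (n + n1)"])
      show "strict_mono (\<lambda>n. r (n + n1))" using r by (simp add: strict_mono_def)
      show "(\<lambda>n. c (r (n + n1)) + a (n + n1)) \<longlonglongrightarrow> \<delta> + 0"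
        using LIMSEQ_ignore_initial_segment[OF tendsto_add[OF cr a]] .
      fix n
      define j where "j = r (n + n1)"
      have "U \<subseteq> {z. \<bar>F z - g j (q z)\<bar> > c j} \<union> {z. \<bar>g j (q z) - G (q z)\<bar> > \<eta>}"
      proof
        fix z assume "z \<in> U"
        moreover have "c j < \<delta> + \<eta>" unfolding j_def by (rule n1) simp
        ultimately show "z \<in> {z. \<bar>F z - g j (q z)\<bar> > c j} \<union> {z. \<bar>g j (q z) - G (q z)\<bar> > \<eta>}"
          unfolding U_def Un_iff mem_Collect_eq \<eta>_def by linarith
      qed
      then have "measure (M j) U \<le> measure (M j) ({z. \<bar>F z - g j (q z)\<bar> > c j} \<union> {z. \<bar>g j (q z) - G (q z)\<bar> > \<eta>})"
        by (intro M.finite_measure_mono) auto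
      also have "\<dots> \<le> measure (M j) {z. \<bar>F z - g j (q z)\<bar> > c j} + measure (M j) {z. \<bar>g j (q z) - G (q z)\<bar> > \<eta>}"
        by (intro measure_Un_le) auto
      also have "measure (M j) {z. \<bar>g j (q z) - G (q z)\<bar> > \<eta>} = a (n + n1)"
        unfolding a_def j_def by (subst pull[of _ "r (n + n1)"]) auto
      finally show "measure (M (r (n + n1))) U \<le> c (r (n + n1)) + a (n + n1)"
        using dM[of j] by (simp add: j_def)
    qed fact
    then show ?thesis using \<open>0 \<le> \<delta>\<close> that by (intro dKF_le) (auto simp: U_def)
  qed
  then have "dKF N F (G \<circ> q) \<le> \<delta>" by (rule field_le_epsilon)
  then show ?thesis using that G by blast
qed

section \<open>Attainment of the observable distance\<close>

lemma prob_space_unit_interval: "prob_space unit_interval_measure"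
  unfolding unit_interval_measure_def
  by (auto simp: emeasure_restrict_space space_restrict_space intro!: prob_spaceI)

lemma
  assumes "prob_space \<pi>"
  shows dconc_plan_nonneg: "0 \<le> dconc_plan \<pi>" and dconc_plan_le_1: "dconc_plan \<pi> \<le> 1"
proof -
  interpret prob_space \<pi> by fact
  show "0 \<le> dconc_plan \<pi>" unfolding dconc_plan_def
    by (intro hausdorff_dist_nonneg) (auto simp: Lip1_nonempty dKF_nonneg dKF_le_1)
  show "dconc_plan \<pi> \<le> 1" unfolding dconc_plan_def
    by (intro hausdorff_dist_le) (use Lip1_nonempty in \<open>auto simp: dKF_nonneg dKF_le_1\<close>)
qed

text \<open>The Hausdorff distance evaluates the Ky Fan metric only on the two Lipschitz families,
  whose members are measurable, so the change of variables applies to every pair that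
  matters.\<close>

lemma dconc_plan_distr:
  fixes \<Phi> :: "'z \<Rightarrow> 'a::polish_space \<times> 'b::polish_space"
  assumes \<Phi>: "\<Phi> \<in> measurable M borel"
  shows "dconc_plan (distr M borel \<Phi>) = hausdorff_dist (dKF M)
    ((\<lambda>f. f \<circ> (fst \<circ> \<Phi>)) ` Lip1) ((\<lambda>g. g \<circ> (snd \<circ> \<Phi>)) ` Lip1)"
proof -
  have "dKF (distr M borel \<Phi>) (f \<circ> fst) (g \<circ> snd) = dKF M (f \<circ> (fst \<circ> \<Phi>)) (g \<circ> (snd \<circ> \<Phi>))"
    if "f \<in> Lip1" "g \<in> Lip1" for f :: "'a \<Rightarrow> real" and g :: "'b \<Rightarrow> real"
  proof -
    have fs: "fst \<in> borel_measurable (borel :: ('a \<times> 'b) measure)"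
      "snd \<in> borel_measurable (borel :: ('a \<times> 'b) measure)"
      by (intro borel_measurable_continuous_onI continuous_intros)+
    show ?thesis
      using dKF_distr[OF \<Phi> measurable_comp[OF fs(1) Lip1_measurable[OF that(1)]]
          measurable_comp[OF fs(2) Lip1_measurable[OF that(2)]]]
      by (simp add: comp_assoc)
  qed
  then show ?thesis
    unfolding dconc_plan_def hausdorff_dist_def image_image
    by (intro arg_cong2[where f=max] SUP_cong INF_cong refl) auto
qed

text \<open>The plan is the joint law of the two parameters under the same uniform variable.\<close>

lemma transport_plan_of_parameters:
  assumes \<phi>: "parameter mX \<phi>" and \<psi>: "parameter mY \<psi>"
  obtains \<pi> where "\<pi> \<in> transport_plans mX mY"
    "dconc_plan \<pi> = hausdorff_dist (dKF unit_interval_measure) ((\<lambda>f. f \<circ> \<phi>) ` Lip1) ((\<lambda>g. g \<circ> \<psi>) ` Lip1)"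
proof -
  interpret L: prob_space unit_interval_measure by (rule prob_space_unit_interval)
  have [measurable]: "\<phi> \<in> measurable unit_interval_measure borel" "\<psi> \<in> measurable unit_interval_measure borel"
    using \<phi> \<psi> by (auto simp: parameter_def)
  define \<Phi> where "\<Phi> t = (\<phi> t, \<psi> t)" for t
  have \<Phi>: "\<Phi> \<in> measurable unit_interval_measure borel"
    unfolding \<Phi>_def borel_prod[symmetric] by measurable
  have fs: "fst \<in> borel_measurable (borel :: ('a \<times> 'b) measure)"
    "snd \<in> borel_measurable (borel :: ('a \<times> 'b) measure)"
    by (intro borel_measurable_continuous_onI continuous_intros)+
  have o: "fst \<circ> \<Phi> = \<phi>" "snd \<circ> \<Phi> = \<psi>" by (auto simp: \<Phi>_def)
  have "distr unit_interval_measure borel \<Phi> \<in> transport_plans mX mY"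
    unfolding transport_plans_def using \<phi> \<psi> L.prob_space_distr[OF \<Phi>]
    by (simp add: distr_distr[OF fs(1) \<Phi>] distr_distr[OF fs(2) \<Phi>] o parameter_def)
  then show ?thesis using dconc_plan_distr[OF \<Phi>] o by (intro that) auto
qed

text \<open>A parameter of the plan itself, followed by the two projections, gives parameters of the
  marginals whose joint law is the plan.\<close>

lemma parameters_of_transport_plan:
  assumes \<pi>: "\<pi> \<in> transport_plans mX mY"
  obtains \<phi> \<psi> where "parameter mX \<phi>" "parameter mY \<psi>"
    "dconc_plan \<pi> = hausdorff_dist (dKF unit_interval_measure) ((\<lambda>f. f \<circ> \<phi>) ` Lip1) ((\<lambda>g. g \<circ> \<psi>) ` Lip1)"
proof -
  have "mm_space \<pi>" using \<pi> by (simp add: transport_plans_def mm_space_def)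
  then obtain \<Phi> where "parameter \<pi> \<Phi>" by (rule parameter_exists)
  then have \<Phi>: "\<Phi> \<in> measurable unit_interval_measure borel" and eq: "distr unit_interval_measure borel \<Phi> = \<pi>"
    by (auto simp: parameter_def)
  have fs: "fst \<in> borel_measurable (borel :: ('a \<times> 'b) measure)"
    "snd \<in> borel_measurable (borel :: ('a \<times> 'b) measure)"
    by (intro borel_measurable_continuous_onI continuous_intros)+
  have "parameter mX (fst \<circ> \<Phi>)" "parameter mY (snd \<circ> \<Phi>)"
    using \<pi> distr_distr[OF fs(1) \<Phi>] distr_distr[OF fs(2) \<Phi>] measurable_comp[OF \<Phi> fs(1)] measurable_comp[OF \<Phi> fs(2)]
    by (auto simp: parameter_def eq transport_plans_def)
  then show ?thesis using dconc_plan_distr[OF \<Phi>] eq by (intro that) auto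
qed

text \<open>The two preceding constructions show that the sets of values under the two infima
  coincide.\<close>

lemma dconc_eq_Inf_dconc_plan: "dconc mX mY = Inf (dconc_plan ` transport_plans mX mY)"
  unfolding dconc_def
proof (rule arg_cong[where f=Inf], intro equalityI subsetI)
  fix x
  assume "x \<in> {hausdorff_dist (dKF unit_interval_measure) ((\<lambda>f. f \<circ> \<phi>) ` Lip1) ((\<lambda>g. g \<circ> \<psi>) ` Lip1)
    | \<phi> \<psi>. parameter mX \<phi> \<and> parameter mY \<psi>}"
  then obtain \<phi> \<psi> where x: "x = hausdorff_dist (dKF unit_interval_measure) ((\<lambda>f. f \<circ> \<phi>) ` Lip1) ((\<lambda>g. g \<circ> \<psi>) ` Lip1)"
    and "parameter mX \<phi>" "parameter mY \<psi>" by blast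
  from this(2,3) show "x \<in> dconc_plan ` transport_plans mX mY"
    by (rule transport_plan_of_parameters) (metis x imageI)
next
  fix x assume "x \<in> dconc_plan ` transport_plans mX mY"
  then obtain \<pi> where x: "x = dconc_plan \<pi>" and "\<pi> \<in> transport_plans mX mY" by blast
  from this(2) show "x \<in> {hausdorff_dist (dKF unit_interval_measure) ((\<lambda>f. f \<circ> \<phi>) ` Lip1) ((\<lambda>g. g \<circ> \<psi>) ` Lip1)
    | \<phi> \<psi>. parameter mX \<phi> \<and> parameter mY \<psi>}"
    by (rule parameters_of_transport_plan) (unfold x mem_Collect_eq, intro exI conjI)
qed

theorem theorem5p2:
  fixes mX :: "'a::polish_space measure" and mY :: "'b::polish_space measure"
  assumes "mm_space mX" and "mm_space mY"
  shows "\<exists>\<pi>\<in>transport_plans mX mY.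
           dconc mX mY = dconc_plan \<pi> \<and>
           (\<forall>\<pi>'\<in>transport_plans mX mY. dconc_plan \<pi> \<le> dconc_plan \<pi>')"
proof -
  let ?D = "dconc_plan ` transport_plans mX mY"
  \<comment> \<open>Transport plans exist, for instance as the joint law of any two
    parameters.\<close>
  obtain \<phi> where "parameter mX \<phi>" using assms(1) by (rule parameter_exists)
  moreover obtain \<psi> where "parameter mY \<psi>" using assms(2) by (rule parameter_exists)
  ultimately obtain \<pi>0 where "\<pi>0 \<in> transport_plans mX mY" by (rule transport_plan_of_parameters)
  then have ne: "?D \<noteq> {}" by blast
  have "bdd_below ?D"
    by (intro bdd_belowI[of _ 0]) (auto simp: transport_plans_def intro: dconc_plan_nonneg)
  then have lower: "Inf ?D \<le> dconc_plan \<pi>" if "\<pi> \<in> transport_plans mX mY" for \<pi>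
    using that by (intro cInf_lower) auto
  define \<delta> where "\<delta> = Inf ?D"
  have "\<exists>\<pi>\<in>transport_plans mX mY. dconc_plan \<pi> < \<delta> + inverse (real (Suc n))" for n
    using cInf_lessD[OF ne, of "\<delta> + inverse (real (Suc n))"] by (auto simp: \<delta>_def)
  then have "\<exists>\<pi>. \<forall>n. \<pi> n \<in> transport_plans mX mY \<and> dconc_plan (\<pi> n) < \<delta> + inverse (real (Suc n))"
    by (intro choice) blast
  then obtain \<pi> where \<pi>: "\<And>n. \<pi> n \<in> transport_plans mX mY"
    and \<pi>_less: "\<And>n. dconc_plan (\<pi> n) < \<delta> + inverse (real (Suc n))" by blast
  obtain s :: "nat \<Rightarrow> nat" and \<pi>' where s: "strict_mono s" and \<pi>': "\<pi>' \<in> transport_plans mX mY"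
    and lsc: "\<And>U k c c0. \<lbrakk>open U; strict_mono k; \<And>n. measure (\<pi> (s (k n))) U \<le> c n; c \<longlonglongrightarrow> c0\<rbrakk>
      \<Longrightarrow> measure \<pi>' U \<le> c0"
    by (rule transport_plans_compact[OF assms, of \<pi>, OF \<pi>]) (rule that, assumption, assumption, blast)
  have c: "(\<lambda>n. \<delta> + inverse (real (Suc (s n)))) \<longlonglongrightarrow> \<delta>"
    using LIMSEQ_subseq_LIMSEQ[OF LIMSEQ_inverse_real_of_nat_add s] by (simp add: o_def)
  interpret \<pi>: prob_space "\<pi> n" for n using \<pi> by (simp add: transport_plans_def)
  interpret \<pi>': prob_space \<pi>' using \<pi>' by (simp add: transport_plans_def)
  have sets: "sets (\<pi> n) = sets borel" "sets \<pi>' = sets borel" for n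
    using \<pi> \<pi>' by (auto simp: transport_plans_def)
  have marg: "distr (\<pi> n) borel fst = mX" "distr (\<pi> n) borel snd = mY" for n
    using \<pi> by (auto simp: transport_plans_def)
  have fs: "fst \<in> measurable (\<pi> n) borel" "snd \<in> measurable (\<pi> n) borel" for n
    unfolding measurable_cong_sets[OF sets(1) refl]
    by (intro borel_measurable_continuous_onI continuous_intros)+
  have cfs: "continuous_on UNIV (fst :: 'a \<times> 'b \<Rightarrow> 'a)" "continuous_on UNIV (snd :: 'a \<times> 'b \<Rightarrow> 'b)"
    by (intro continuous_intros)+
  have "dconc_plan \<pi>' \<le> \<delta>"
  \<comment> \<open>If \<delta> is at least 1 the claim follows from the general bound 1. Otherwise
    \<delta> is below 1, as is needed to bound the approximating functions at a base point.\<close>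
  proof (cases "\<delta> < 1")
    case False
    then show ?thesis using dconc_plan_le_1[OF \<pi>'.prob_space_axioms] by simp
  next
    case True
    note hd = \<pi>_less[unfolded dconc_plan_def]
    have "\<exists>g\<in>Lip1. dKF \<pi>' (f \<circ> fst) (g \<circ> snd) \<le> \<delta>" if f: "f \<in> Lip1" for f :: "'a \<Rightarrow> real"
    proof -
      have "\<exists>g\<in>Lip1. dKF (\<pi> (s n)) (f \<circ> fst) (g \<circ> snd) < \<delta> + inverse (real (Suc (s n)))" for n
        using hausdorff_dist_lessD1[OF _ _ \<pi>.dKF_nonneg \<pi>.dKF_le_1 hd[of "s n"], of "f \<circ> fst"] f
        by (auto simp: Lip1_nonempty)
      then obtain g where g: "\<And>n. g n \<in> Lip1"
        "\<And>n. dKF (\<pi> (s n)) (f \<circ> fst) (g n \<circ> snd) < \<delta> + inverse (real (Suc (s n)))" by metis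
      have "distr (\<pi> (s n)) borel (f \<circ> fst) = distr mX borel f" for n
        using distr_distr[OF Lip1_measurable[OF f] fs(1)] by (simp add: marg)
      then obtain h where "h \<in> Lip1" "dKF \<pi>' (f \<circ> fst) (h \<circ> snd) \<le> \<delta>"
        by (rule Lip1_approximation_limit[OF \<pi>.prob_space_axioms sets(1) \<pi>'.prob_space_axioms sets(2)
              continuous_on_compose[OF cfs(1) Lip1_continuous[OF f]] cfs(2) _ marg(2) _ g c True])
          (rule lsc)
      then show ?thesis by blast
    qed
    \<comment> \<open>The same argument with the projections exchanged; symmetry of the Ky Fan
      metric restores the order of the arguments.\<close>
    moreover have "\<exists>f\<in>Lip1. dKF \<pi>' (f \<circ> fst) (g \<circ> snd) \<le> \<delta>" if g: "g \<in> Lip1" for g :: "'b \<Rightarrow> real"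
    proof -
      have "\<exists>f\<in>Lip1. dKF (\<pi> (s n)) (g \<circ> snd) (f \<circ> fst) < \<delta> + inverse (real (Suc (s n)))" for n
        using hausdorff_dist_lessD2[OF _ _ \<pi>.dKF_nonneg \<pi>.dKF_le_1 hd[of "s n"], of "g \<circ> snd"] g
        by (auto simp: Lip1_nonempty dKF_commute)
      then obtain f where f: "\<And>n. f n \<in> Lip1"
        "\<And>n. dKF (\<pi> (s n)) (g \<circ> snd) (f n \<circ> fst) < \<delta> + inverse (real (Suc (s n)))" by metis
      have "distr (\<pi> (s n)) borel (g \<circ> snd) = distr mY borel g" for n
        using distr_distr[OF Lip1_measurable[OF g] fs(2)] by (simp add: marg)
      then obtain h where "h \<in> Lip1" "dKF \<pi>' (g \<circ> snd) (h \<circ> fst) \<le> \<delta>"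
        by (rule Lip1_approximation_limit[OF \<pi>.prob_space_axioms sets(1) \<pi>'.prob_space_axioms sets(2)
              continuous_on_compose[OF cfs(2) Lip1_continuous[OF g]] cfs(1) _ marg(1) _ f c True])
          (rule lsc)
      then show ?thesis using dKF_commute by metis
    qed
    ultimately show ?thesis unfolding dconc_plan_def
      by (intro hausdorff_dist_le) (auto simp: Lip1_nonempty \<pi>'.dKF_nonneg)
  qed
  then have "dconc_plan \<pi>' = Inf ?D" using lower[OF \<pi>'] by (simp add: \<delta>_def)
  then show ?thesis using lower by (intro bexI[OF _ \<pi>']) (simp add: dconc_eq_Inf_dconc_plan)
qed

end
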